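(* Let $A$ be a local principal ideal commutative ring of length $\ell\in\mathbb{N}\cup\{\infty\}$ with maximal ideal $\mathfrak{m}$ and finite residue field of cardinality $q$. For every integer $\imath$ with $1\le\imath\le\ell$, put $A_\imath=A/\mathfrak{m}^\imath$. Then the number of similarity classes in $M_2(A_\imath)$ is $(q^{2\imath+1}-q^\imath)/(q-1)$, and the number of similarity classes in $\mathrm{GL}_2(A_\imath)$ is $q^{2\imath}-q^{\imath-1}$.
   Context: The length $\ell$ of $A$ is the smallest positive integer with $\mathfrak{m}^\ell=0$, and $\ell=\infty$ if there is none. Two matrices $\alpha,\alpha'\in M_2(R)$ over a commutative ring $R$ are similar if $X\alpha=\alpha'X$ for some $X\in\mathrm{GL}_2(R)$; similarity classes in $\mathrm{GL}_2(R)$ are its conjugacy classes. *)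

theory Defs
  imports "HOL-Library.Extended_Nat" "HOL-Algebra.QuotRing" "HOL-Algebra.Ideal_Product" Complex_Main
begin

text \<open>Powers of ideals are powers in the monoid \<^const>\<open>ideals_set\<close>
  (product of ideals, with unit the whole ring).\<close>

abbreviation ideal_power :: "('a, 'b) ring_scheme \<Rightarrow> 'a set \<Rightarrow> nat \<Rightarrow> 'a set"
  where "ideal_power R I n \<equiv> I [^]\<^bsub>ideals_set R\<^esub> n"

locale local_principal_ideal_ring = cring R + maximalideal \<mm> R
  for R (structure) and \<mm> +
  assumes maximalideal_unique: "maximalideal J R \<Longrightarrow> J = \<mm>"
    and all_ideals_principal: "ideal I R \<Longrightarrow> principalideal I R"

definition local_length :: "('a, 'b) ring_scheme \<Rightarrow> 'a set \<Rightarrow> enat"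
  where "local_length R \<mm> =
    (if \<exists>l\<ge>1. ideal_power R \<mm> l = {\<zero>\<^bsub>R\<^esub>}
     then enat (LEAST l. l \<ge> 1 \<and> ideal_power R \<mm> l = {\<zero>\<^bsub>R\<^esub>})
     else \<infinity>)"

text \<open>A quadruple \<open>(a, b, c, d)\<close> is the matrix with rows \<open>(a, b)\<close> and \<open>(c, d)\<close>.\<close>

type_synonym 'a mat2 = "'a \<times> 'a \<times> 'a \<times> 'a"

definition M2 :: "('a, 'b) ring_scheme \<Rightarrow> 'a mat2 ring"
  where "M2 R =
    \<lparr>carrier = carrier R \<times> carrier R \<times> carrier R \<times> carrier R,
     mult = (\<lambda>(a, b, c, d) (a', b', c', d').
       (a \<otimes>\<^bsub>R\<^esub> a' \<oplus>\<^bsub>R\<^esub> b \<otimes>\<^bsub>R\<^esub> c', a \<otimes>\<^bsub>R\<^esub> b' \<oplus>\<^bsub>R\<^esub> b \<otimes>\<^bsub>R\<^esub> d',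
        c \<otimes>\<^bsub>R\<^esub> a' \<oplus>\<^bsub>R\<^esub> d \<otimes>\<^bsub>R\<^esub> c', c \<otimes>\<^bsub>R\<^esub> b' \<oplus>\<^bsub>R\<^esub> d \<otimes>\<^bsub>R\<^esub> d')),
     one = (\<one>\<^bsub>R\<^esub>, \<zero>\<^bsub>R\<^esub>, \<zero>\<^bsub>R\<^esub>, \<one>\<^bsub>R\<^esub>),
     zero = (\<zero>\<^bsub>R\<^esub>, \<zero>\<^bsub>R\<^esub>, \<zero>\<^bsub>R\<^esub>, \<zero>\<^bsub>R\<^esub>),
     add = (\<lambda>(a, b, c, d) (a', b', c', d').
       (a \<oplus>\<^bsub>R\<^esub> a', b \<oplus>\<^bsub>R\<^esub> b', c \<oplus>\<^bsub>R\<^esub> c', d \<oplus>\<^bsub>R\<^esub> d'))\<rparr>"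

lemma (in cring) M2_ring: "ring (M2 R)"
proof (rule ringI)
  show "abelian_group (M2 R)"
  proof (rule abelian_groupI)
    fix x assume "x \<in> carrier (M2 R)"
    then obtain a b c d where x: "x = (a, b, c, d)"
      "a \<in> carrier R" "b \<in> carrier R" "c \<in> carrier R" "d \<in> carrier R"
      by (auto simp: M2_def)
    show "\<exists>y\<in>carrier (M2 R). y \<oplus>\<^bsub>M2 R\<^esub> x = \<zero>\<^bsub>M2 R\<^esub>"
      using x by (intro bexI[of _ "(\<ominus> a, \<ominus> b, \<ominus> c, \<ominus> d)"]) (auto simp: M2_def l_neg)
  qed (auto simp: M2_def a_ac)
  show "monoid (M2 R)"
    by (rule monoidI) (auto simp: M2_def l_distr r_distr m_assoc a_ac)
qed (auto simp: M2_def l_distr r_distr a_ac)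

abbreviation GL2 :: "('a, 'b) ring_scheme \<Rightarrow> 'a mat2 set"
  where "GL2 R \<equiv> Units (M2 R)"

definition similar_mat2 :: "('a, 'b) ring_scheme \<Rightarrow> 'a mat2 \<Rightarrow> 'a mat2 \<Rightarrow> bool"
  where "similar_mat2 R \<alpha> \<alpha>' \<longleftrightarrow> (\<exists>X\<in>GL2 R. X \<otimes>\<^bsub>M2 R\<^esub> \<alpha> = \<alpha>' \<otimes>\<^bsub>M2 R\<^esub> X)"

definition similarity_classes :: "('a, 'b) ring_scheme \<Rightarrow> 'a mat2 set \<Rightarrow> 'a mat2 set set"
  where "similarity_classes R S = S // {(\<alpha>, \<alpha>'). \<alpha> \<in> S \<and> \<alpha>' \<in> S \<and> similar_mat2 R \<alpha> \<alpha>'}"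

end

(* Let p generate the maximal ideal. A 2x2 matrix that is not scalar modulo p has a cyclic vector,
   hence is similar to the companion matrix of its characteristic polynomial, and its class is
   determined by trace and determinant: over the ring of length n + 1 these give q^(2n+2) classes.
   Any other matrix is d + p \<beta> with d unique among q residue representatives and the class of \<beta>
   unique modulo p^n, so the number of classes satisfies s (n + 1) = q^(2n+2) + q s n with s 0 = 1.
   In the second kind the invertible matrices are those with d a unit, which replaces q by q - 1.
   Everything is done with matrices over A and similarity modulo p^n, so that p^n may vary in
   the induction. *)

theory Submission
  imports Defs "HOL-Algebra.Ring_Divisibility"
begin

section \<open>Two-by-two matrices over a commutative ring\<close>

definition mdet :: "('a, 'b) ring_scheme \<Rightarrow> 'a mat2 \<Rightarrow> 'a"
  where "mdet R = (\<lambda>(a, b, c, d). a \<otimes>\<^bsub>R\<^esub> d \<ominus>\<^bsub>R\<^esub> b \<otimes>\<^bsub>R\<^esub> c)"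

definition mtrace :: "('a, 'b) ring_scheme \<Rightarrow> 'a mat2 \<Rightarrow> 'a"
  where "mtrace R = (\<lambda>(a, b, c, d). a \<oplus>\<^bsub>R\<^esub> d)"

lemma carrier_M2 [simp]: "carrier (M2 R) = carrier R \<times> carrier R \<times> carrier R \<times> carrier R"
  by (simp add: M2_def)

lemma mult_M2 [simp]: "(a, b, c, d) \<otimes>\<^bsub>M2 R\<^esub> (a', b', c', d') =
   (a \<otimes>\<^bsub>R\<^esub> a' \<oplus>\<^bsub>R\<^esub> b \<otimes>\<^bsub>R\<^esub> c', a \<otimes>\<^bsub>R\<^esub> b' \<oplus>\<^bsub>R\<^esub> b \<otimes>\<^bsub>R\<^esub> d',
    c \<otimes>\<^bsub>R\<^esub> a' \<oplus>\<^bsub>R\<^esub> d \<otimes>\<^bsub>R\<^esub> c', c \<otimes>\<^bsub>R\<^esub> b' \<oplus>\<^bsub>R\<^esub> d \<otimes>\<^bsub>R\<^esub> d')"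
  by (simp add: M2_def)

lemma one_M2: "\<one>\<^bsub>M2 R\<^esub> = (\<one>\<^bsub>R\<^esub>, \<zero>\<^bsub>R\<^esub>, \<zero>\<^bsub>R\<^esub>, \<one>\<^bsub>R\<^esub>)"
  by (simp add: M2_def)

context cring
begin

lemma mdet_closed [simp]: "X \<in> carrier (M2 R) \<Longrightarrow> mdet R X \<in> carrier R"
  by (auto simp: mdet_def)

lemma mtrace_closed [simp]: "X \<in> carrier (M2 R) \<Longrightarrow> mtrace R X \<in> carrier R"
  by (auto simp: mtrace_def)

lemma mdet_one [simp]: "mdet R \<one>\<^bsub>M2 R\<^esub> = \<one>"
  by (simp add: one_M2 mdet_def minus_eq)

lemma mdet_mult:
  assumes "X \<in> carrier (M2 R)" "Y \<in> carrier (M2 R)"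
  shows "mdet R (X \<otimes>\<^bsub>M2 R\<^esub> Y) = mdet R X \<otimes> mdet R Y"
proof -
  obtain a b c d a' b' c' d' where "X = (a, b, c, d)" "Y = (a', b', c', d')"
    by (metis prod_cases4)
  moreover have "a \<in> carrier R" "b \<in> carrier R" "c \<in> carrier R" "d \<in> carrier R"
    "a' \<in> carrier R" "b' \<in> carrier R" "c' \<in> carrier R" "d' \<in> carrier R"
    using assms calculation by auto
  ultimately show ?thesis
    unfolding mdet_def by simp algebra
qed

lemma mtrace_mult_commute:
  assumes "X \<in> carrier (M2 R)" "Y \<in> carrier (M2 R)"
  shows "mtrace R (X \<otimes>\<^bsub>M2 R\<^esub> Y) = mtrace R (Y \<otimes>\<^bsub>M2 R\<^esub> X)"
  using assms by (auto simp: mtrace_def m_comm a_ac)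

lemma GL2_iff:
  assumes "X \<in> carrier (M2 R)"
  shows "X \<in> GL2 R \<longleftrightarrow> mdet R X \<in> Units R"
proof
  interpret M: ring "M2 R" by (rule M2_ring)
  assume "X \<in> GL2 R"
  then obtain Y where Y: "Y \<in> carrier (M2 R)" "X \<otimes>\<^bsub>M2 R\<^esub> Y = \<one>\<^bsub>M2 R\<^esub>"
    by (auto simp: Units_def)
  then have "mdet R X \<otimes> mdet R Y = \<one>"
    using mdet_mult[OF assms Y(1)] by simp
  then show "mdet R X \<in> Units R"
    using Y assms by (metis Units_one_closed mdet_closed unit_factor)
next
  assume u: "mdet R X \<in> Units R"
  obtain a b c d where X: "X = (a, b, c, d)"
    by (metis prod_cases4)
  have c: "a \<in> carrier R" "b \<in> carrier R" "c \<in> carrier R" "d \<in> carrier R"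
    using assms X by auto
  define v where "v = inv (mdet R X)"
  have v: "v \<in> carrier R" "(a \<otimes> d \<ominus> b \<otimes> c) \<otimes> v = \<one>"
    using u X by (auto simp: v_def mdet_def)
  define Y where "Y = (v \<otimes> d, \<ominus> (v \<otimes> b), \<ominus> (v \<otimes> c), v \<otimes> a)"
  have Y: "Y \<in> carrier (M2 R)"
    using c v by (simp add: Y_def)
  have e: "a \<otimes> (v \<otimes> d) \<oplus> b \<otimes> (\<ominus> (v \<otimes> c)) = (a \<otimes> d \<ominus> b \<otimes> c) \<otimes> v"
    "a \<otimes> (\<ominus> (v \<otimes> b)) \<oplus> b \<otimes> (v \<otimes> a) = \<zero>"
    "c \<otimes> (v \<otimes> d) \<oplus> d \<otimes> (\<ominus> (v \<otimes> c)) = \<zero>"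
    "c \<otimes> (\<ominus> (v \<otimes> b)) \<oplus> d \<otimes> (v \<otimes> a) = (a \<otimes> d \<ominus> b \<otimes> c) \<otimes> v"
    "v \<otimes> d \<otimes> a \<oplus> \<ominus> (v \<otimes> b) \<otimes> c = (a \<otimes> d \<ominus> b \<otimes> c) \<otimes> v"
    "v \<otimes> d \<otimes> b \<oplus> \<ominus> (v \<otimes> b) \<otimes> d = \<zero>"
    "\<ominus> (v \<otimes> c) \<otimes> a \<oplus> v \<otimes> a \<otimes> c = \<zero>"
    "\<ominus> (v \<otimes> c) \<otimes> b \<oplus> v \<otimes> a \<otimes> d = (a \<otimes> d \<ominus> b \<otimes> c) \<otimes> v"
    using c v(1) by algebra+
  have "X \<otimes>\<^bsub>M2 R\<^esub> Y = \<one>\<^bsub>M2 R\<^esub>" "Y \<otimes>\<^bsub>M2 R\<^esub> X = \<one>\<^bsub>M2 R\<^esub>"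
    unfolding X Y_def mult_M2 one_M2 e v(2) by simp_all
  with Y assms show "X \<in> GL2 R"
    unfolding Units_def by blast
qed

lemma similar_mat2_invariants:
  assumes "\<alpha> \<in> carrier (M2 R)" "\<alpha>' \<in> carrier (M2 R)" "similar_mat2 R \<alpha> \<alpha>'"
  shows "mdet R \<alpha> = mdet R \<alpha>'" "mtrace R \<alpha> = mtrace R \<alpha>'"
proof -
  interpret M: ring "M2 R" by (rule M2_ring)
  obtain X where X: "X \<in> GL2 R" "X \<otimes>\<^bsub>M2 R\<^esub> \<alpha> = \<alpha>' \<otimes>\<^bsub>M2 R\<^esub> X"
    using assms by (auto simp: similar_mat2_def)
  have Xc: "X \<in> carrier (M2 R)" using X(1) by blast
  have u: "mdet R X \<in> Units R"
    using X(1) Xc GL2_iff by blast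
  have "mdet R X \<otimes> mdet R \<alpha> = mdet R \<alpha>' \<otimes> mdet R X"
    using X(2) mdet_mult[OF Xc assms(1)] mdet_mult[OF assms(2) Xc] by simp
  then show "mdet R \<alpha> = mdet R \<alpha>'"
    using u Xc assms by (metis Units_l_cancel m_comm mdet_closed)
  let ?Y = "inv\<^bsub>M2 R\<^esub> X"
  have Y: "?Y \<in> carrier (M2 R)" "?Y \<otimes>\<^bsub>M2 R\<^esub> X = \<one>\<^bsub>M2 R\<^esub>" "X \<otimes>\<^bsub>M2 R\<^esub> ?Y = \<one>\<^bsub>M2 R\<^esub>"
    using X(1) M.Units_inv_closed M.Units_l_inv M.Units_r_inv by blast+
  have "\<alpha> = ?Y \<otimes>\<^bsub>M2 R\<^esub> (X \<otimes>\<^bsub>M2 R\<^esub> \<alpha>)"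
    using Y Xc assms(1) by (metis M.l_one M.m_assoc)
  then have "mtrace R \<alpha> = mtrace R (X \<otimes>\<^bsub>M2 R\<^esub> \<alpha> \<otimes>\<^bsub>M2 R\<^esub> ?Y)"
    using mtrace_mult_commute[OF Y(1) M.m_closed[OF Xc assms(1)]] by simp
  also have "X \<otimes>\<^bsub>M2 R\<^esub> \<alpha> \<otimes>\<^bsub>M2 R\<^esub> ?Y = \<alpha>'"
    unfolding X(2) using M.m_assoc[OF assms(2) Xc Y(1)] Y(3) M.r_one[OF assms(2)] by simp
  finally show "mtrace R \<alpha> = mtrace R \<alpha>'" .
qed

lemma equiv_similar_mat2:
  assumes "S \<subseteq> carrier (M2 R)"
  shows "equiv S {(\<alpha>, \<alpha>'). \<alpha> \<in> S \<and> \<alpha>' \<in> S \<and> similar_mat2 R \<alpha> \<alpha>'}"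
proof -
  interpret M: ring "M2 R" by (rule M2_ring)
  have refl: "similar_mat2 R \<alpha> \<alpha>" if "\<alpha> \<in> carrier (M2 R)" for \<alpha>
    unfolding similar_mat2_def using that M.Units_one_closed M.l_one M.r_one by metis
  have sym: "similar_mat2 R \<alpha>' \<alpha>"
    if c: "\<alpha> \<in> carrier (M2 R)" "\<alpha>' \<in> carrier (M2 R)" and s: "similar_mat2 R \<alpha> \<alpha>'" for \<alpha> \<alpha>'
  proof -
    obtain X where X: "X \<in> GL2 R" "X \<otimes>\<^bsub>M2 R\<^esub> \<alpha> = \<alpha>' \<otimes>\<^bsub>M2 R\<^esub> X"
      using s by (auto simp: similar_mat2_def)
    let ?Y = "inv\<^bsub>M2 R\<^esub> X"
    have Y: "?Y \<in> GL2 R" "?Y \<in> carrier (M2 R)" "X \<in> carrier (M2 R)"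
      "?Y \<otimes>\<^bsub>M2 R\<^esub> X = \<one>\<^bsub>M2 R\<^esub>" "X \<otimes>\<^bsub>M2 R\<^esub> ?Y = \<one>\<^bsub>M2 R\<^esub>"
      using X(1) by (auto simp del: carrier_M2)
    have "?Y \<otimes>\<^bsub>M2 R\<^esub> \<alpha>' = ?Y \<otimes>\<^bsub>M2 R\<^esub> (\<alpha>' \<otimes>\<^bsub>M2 R\<^esub> X) \<otimes>\<^bsub>M2 R\<^esub> ?Y"
      using Y c by (simp add: M.m_assoc del: carrier_M2)
    also have "\<dots> = \<alpha> \<otimes>\<^bsub>M2 R\<^esub> ?Y"
      using Y c by (simp add: X(2)[symmetric] M.m_assoc[symmetric] del: carrier_M2)
    finally show ?thesis
      using Y(1) by (auto simp: similar_mat2_def)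
  qed
  have trans: "similar_mat2 R \<alpha> \<alpha>''"
    if c: "\<alpha> \<in> carrier (M2 R)" "\<alpha>' \<in> carrier (M2 R)" "\<alpha>'' \<in> carrier (M2 R)"
      and s: "similar_mat2 R \<alpha> \<alpha>'" "similar_mat2 R \<alpha>' \<alpha>''" for \<alpha> \<alpha>' \<alpha>''
  proof -
    obtain X Y where X: "X \<in> GL2 R" "X \<otimes>\<^bsub>M2 R\<^esub> \<alpha> = \<alpha>' \<otimes>\<^bsub>M2 R\<^esub> X"
      and Y: "Y \<in> GL2 R" "Y \<otimes>\<^bsub>M2 R\<^esub> \<alpha>' = \<alpha>'' \<otimes>\<^bsub>M2 R\<^esub> Y"
      using s by (auto simp: similar_mat2_def)
    have XY: "X \<in> carrier (M2 R)" "Y \<in> carrier (M2 R)"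
      using X Y by (auto simp del: carrier_M2)
    have "Y \<otimes>\<^bsub>M2 R\<^esub> X \<otimes>\<^bsub>M2 R\<^esub> \<alpha> = Y \<otimes>\<^bsub>M2 R\<^esub> \<alpha>' \<otimes>\<^bsub>M2 R\<^esub> X"
      using XY c X(2) by (simp add: M.m_assoc del: carrier_M2)
    also have "\<dots> = \<alpha>'' \<otimes>\<^bsub>M2 R\<^esub> (Y \<otimes>\<^bsub>M2 R\<^esub> X)"
      using XY c Y(2) by (simp add: M.m_assoc del: carrier_M2)
    finally show ?thesis
      using X(1) Y(1) M.Units_m_closed unfolding similar_mat2_def by blast
  qed
  show ?thesis
    unfolding equiv_def refl_on_def sym_def trans_def
    using assms by (auto simp del: carrier_M2 intro: refl sym trans)
qed

lemma similar_mat2_scalar: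
  assumes "d \<in> carrier R" "\<alpha> \<in> carrier (M2 R)"
    and "similar_mat2 R (d, \<zero>, \<zero>, d) \<alpha> \<or> similar_mat2 R \<alpha> (d, \<zero>, \<zero>, d)"
  shows "\<alpha> = (d, \<zero>, \<zero>, d)"
proof -
  interpret M: ring "M2 R" by (rule M2_ring)
  let ?D = "(d, \<zero>, \<zero>, d)"
  have D: "?D \<in> carrier (M2 R)" using assms by simp
  have "similar_mat2 R ?D \<alpha>"
    using assms D equivE[OF equiv_similar_mat2[OF order_refl]]
    by (smt (verit, ccfv_threshold) case_prodD case_prodI mem_Collect_eq symD)
  then obtain X where X: "X \<in> GL2 R" "X \<otimes>\<^bsub>M2 R\<^esub> ?D = \<alpha> \<otimes>\<^bsub>M2 R\<^esub> X"
    by (auto simp: similar_mat2_def)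
  have Xc: "X \<in> carrier (M2 R)" using X(1) by blast
  have "X \<otimes>\<^bsub>M2 R\<^esub> ?D = ?D \<otimes>\<^bsub>M2 R\<^esub> X"
    using Xc assms(1) by (auto simp: m_comm)
  then have "\<alpha> \<otimes>\<^bsub>M2 R\<^esub> X \<otimes>\<^bsub>M2 R\<^esub> inv\<^bsub>M2 R\<^esub> X = ?D \<otimes>\<^bsub>M2 R\<^esub> X \<otimes>\<^bsub>M2 R\<^esub> inv\<^bsub>M2 R\<^esub> X"
    using X(2) by simp
  then show ?thesis
    using X(1) Xc D assms(2) M.m_assoc M.Units_r_inv M.Units_inv_closed M.r_one by metis
qed

end

section \<open>Powers of the maximal ideal and residue representatives\<close>

locale uniformized_ring = local_principal_ideal_ring +
  fixes p
  assumes p_closed [simp]: "p \<in> carrier R" and p_gen: "\<mm> = PIdl p"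
begin

definition mpow :: "nat \<Rightarrow> 'a set"
  where "mpow n = PIdl (p [^] n)"

lemma mpow_ideal: "ideal (mpow n) R"
  by (simp add: mpow_def cgenideal_ideal)

lemma mpow_iff: "x \<in> mpow n \<longleftrightarrow> (\<exists>y\<in>carrier R. x = p [^] n \<otimes> y)"
  unfolding mpow_def cgenideal_def using m_comm by (auto simp: m_comm)

lemma mem_mpow_closed: "x \<in> mpow n \<Longrightarrow> x \<in> carrier R"
  by (auto simp: mpow_iff)

lemma mpow_0: "mpow 0 = carrier R"
  by (auto simp: mpow_iff)

lemma mpow_1: "mpow (Suc 0) = \<mm>"
  by (simp add: p_gen mpow_def)

lemma mem_mm_iff_mult: "x \<in> \<mm> \<longleftrightarrow> (\<exists>y\<in>carrier R. x = p \<otimes> y)"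
  using mpow_iff[of x "Suc 0"] by (simp add: mpow_1)

lemma mpow_Suc_subset: "mpow (Suc n) \<subseteq> mpow n"
  by (auto simp: mpow_iff m_assoc intro!: bexI[of _ "p \<otimes> _"])

lemma mpow_antimono: "m \<le> n \<Longrightarrow> mpow n \<subseteq> mpow m"
  by (rule lift_Suc_antimono_le[of mpow]) (rule mpow_Suc_subset)

lemma ideal_power_eq: "ideal_power R \<mm> n = mpow n"
proof (induction n)
  case 0
  then show ?case by (simp add: mpow_0) (simp add: ideals_set_def nat_pow_def)
next
  case (Suc n)
  have "ideal_power R \<mm> (Suc n) = ideal_prod R (mpow n) (PIdl p)"
    using Suc p_gen by (simp add: ideals_set_def nat_pow_def)
  also have "\<dots> = Idl (mpow n <#> PIdl p)"
    by (simp add: mpow_ideal ideal_prod_eq_genideal cgenideal_ideal)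
  also have "\<dots> = Idl (mpow (Suc n))"
    by (simp add: mpow_def cgenideal_prod)
  also have "\<dots> = mpow (Suc n)"
    using Idl_subset_ideal[OF mpow_ideal] genideal_self[of "mpow (Suc n)"] mem_mpow_closed
    by blast
  finally show ?case .
qed

lemma Units_iff:
  assumes "x \<in> carrier R"
  shows "x \<in> Units R \<longleftrightarrow> x \<notin> \<mm>"
proof
  assume x: "x \<in> Units R"
  show "x \<notin> \<mm>"
  proof
    assume "x \<in> \<mm>"
    from I_l_closed[OF this Units_inv_closed[OF x]] have "\<one> \<in> \<mm>"
      using x by simp
    then show False using I_notcarr one_imp_carrier by blast
  qed
next
  assume x: "x \<notin> \<mm>"
  show "x \<in> Units R"
  proof (rule ccontr)
    assume nu: "x \<notin> Units R"
    let ?A = "{J. ideal J R \<and> PIdl x \<subseteq> J \<and> \<one> \<notin> J}"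
    have "\<exists>M\<in>?A. \<forall>J\<in>?A. M \<subseteq> J \<longrightarrow> J = M"
    proof (rule subset_Zorn_nonempty)
      have "\<one> \<notin> PIdl x"
      proof
        assume "\<one> \<in> PIdl x"
        then obtain y where "y \<in> carrier R" "\<one> = y \<otimes> x"
          by (auto simp: cgenideal_def)
        then show False
          using nu assms m_comm[of x y] by (auto simp: Units_def)
      qed
      then show "?A \<noteq> {}" using cgenideal_ideal[OF assms] by auto
      fix C assume C: "C \<noteq> {}" "subset.chain ?A C"
      then have CA: "C \<subseteq> ?A" by (simp add: subset_chain_def)
      have "subset.chain {J. ideal J R} C"
        using C CA by (auto simp: subset_chain_def)
      from chain_Union_is_ideal[OF this] C(1) have "ideal (\<Union>C) R" by simp
      with C(1) CA show "\<Union>C \<in> ?A" by auto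
    qed
    then obtain M where MA: "M \<in> ?A" and mx: "\<forall>J\<in>?A. M \<subseteq> J \<longrightarrow> J = M"
      by (rule bexE)
    from MA have M: "ideal M R" "PIdl x \<subseteq> M" "\<one> \<notin> M" by simp_all
    have "maximalideal M R"
    proof (rule maximalidealI)
      fix J assume J: "ideal J R" "M \<subseteq> J"
      show "J = M \<or> J = carrier R"
      proof (cases "\<one> \<in> J")
        case True
        then show ?thesis using ideal.one_imp_carrier[OF J(1)] by blast
      next
        case False
        then have "J \<in> ?A" using J M(2) by simp
        then show ?thesis using mx J(2) by blast
      qed
    qed (use M in auto)
    then have "M = \<mm>" by (rule maximalideal_unique)
    then show False using x M(2) cgenideal_self[OF assms] by blast
  qed
qed

lemma mm_prime:
  assumes "x \<in> carrier R" "y \<in> carrier R"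
  shows "x \<otimes> y \<in> \<mm> \<longleftrightarrow> x \<in> \<mm> \<or> y \<in> \<mm>"
proof (cases "x \<in> \<mm> \<or> y \<in> \<mm>")
  case True
  then show ?thesis using assms I_l_closed I_r_closed by blast
next
  case False
  then have "x \<otimes> y \<in> Units R" using assms Units_iff Units_m_closed by blast
  then show ?thesis using False assms Units_iff by blast
qed

lemma coset_eq_iff:
  assumes "x \<in> carrier R" "y \<in> carrier R"
  shows "mpow n +> x = mpow n +> y \<longleftrightarrow> x \<ominus> y \<in> mpow n"
  using quotient_eq_iff_same_a_r_cos[OF mpow_ideal assms] by simp

lemma coset_antimono:
  assumes "x \<in> carrier R" "y \<in> carrier R" "m \<le> n" "mpow n +> x = mpow n +> y"
  shows "mpow m +> x = mpow m +> y"
  using assms mpow_antimono by (auto simp: coset_eq_iff)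

text \<open>An element \<open>p [^] k \<otimes> u\<close> with \<open>u\<close> a unit that is killed by \<open>p\<close> forces \<open>p [^] Suc k = \<zero>\<close>,
  so below the length the annihilator of \<open>p\<close> is contained in \<open>mpow n\<close>.\<close>

lemma p_mult_mem_iff:
  assumes n: "enat (Suc n) \<le> local_length R \<mm>" and z: "z \<in> carrier R"
  shows "p \<otimes> z \<in> mpow (Suc n) \<longleftrightarrow> z \<in> mpow n"
proof
  assume "z \<in> mpow n"
  then show "p \<otimes> z \<in> mpow (Suc n)"
    by (auto simp: mpow_iff m_ac)
next
  have nz: "mpow k \<noteq> {\<zero>}" if "1 \<le> k" "k \<le> n" for k
  proof
    assume k: "mpow k = {\<zero>}"
    then have "local_length R \<mm> = enat (LEAST l. l \<ge> 1 \<and> mpow l = {\<zero>})"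
      using that by (auto simp: local_length_def ideal_power_eq)
    also have "(LEAST l. l \<ge> 1 \<and> mpow l = {\<zero>}) \<le> k"
      using that k by (intro Least_le) auto
    finally have "local_length R \<mm> \<le> enat k" by simp
    with n that show False using order_trans[OF n] by fastforce
  qed
  assume "p \<otimes> z \<in> mpow (Suc n)"
  then obtain y where y: "y \<in> carrier R" "p \<otimes> z = p [^] Suc n \<otimes> y"
    by (auto simp: mpow_iff)
  define w where "w = z \<ominus> p [^] n \<otimes> y"
  have w: "w \<in> carrier R" using y z by (simp add: w_def)
  have "p \<otimes> w = p \<otimes> z \<ominus> p [^] n \<otimes> p \<otimes> y"
  proof -
    have "p [^] n \<in> carrier R" by simp
    then show ?thesis using y(1) z p_closed unfolding w_def by algebra
  qed
  also have "\<dots> = \<zero>" using y z by (simp add: minus_eq r_neg)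
  finally have pw: "p \<otimes> w = \<zero>" .
  have "w \<in> mpow k" if "k \<le> n" for k
    using that
  proof (induction k)
    case 0 then show ?case using w mpow_0 by simp
  next
    case (Suc k)
    then obtain u where u: "u \<in> carrier R" "w = p [^] k \<otimes> u"
      by (auto simp: mpow_iff)
    have "u \<in> \<mm>"
    proof (rule ccontr)
      assume "u \<notin> \<mm>"
      then have uU: "u \<in> Units R" using Units_iff u by blast
      have "p [^] Suc k \<otimes> u = \<zero>"
        using pw u by (simp add: m_ac)
      then have "p [^] Suc k = \<zero>"
        using uU u(1) by (metis Units_inv_closed Units_r_inv l_null m_assoc nat_pow_closed p_closed r_one)
      then have "mpow (Suc k) = {\<zero>}"
        using zero_closed by (fastforce simp: mpow_iff simp del: nat_pow_Suc)
      then show False using nz[of "Suc k"] Suc.prems by simp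
    qed
    then obtain v where "v \<in> carrier R" "u = p \<otimes> v"
      by (auto simp: mem_mm_iff_mult)
    with u show ?case by (auto simp: mpow_iff m_assoc)
  qed
  then have "w \<in> mpow n" by simp
  then obtain v where v: "v \<in> carrier R" "w = p [^] n \<otimes> v"
    by (auto simp: mpow_iff)
  have "p [^] n \<in> carrier R" by simp
  then have "z = w \<oplus> p [^] n \<otimes> y"
    using y(1) z p_closed unfolding w_def by algebra
  then have "z = p [^] n \<otimes> (v \<oplus> y)"
    using v y(1) by (simp add: r_distr)
  then show "z \<in> mpow n" using v y(1) by (auto simp: mpow_iff)
qed

lemma coset_Suc_eq_iff:
  assumes "enat (Suc n) \<le> local_length R \<mm>"
    and "d \<in> carrier R" "x \<in> carrier R" "y \<in> carrier R"
  shows "mpow (Suc n) +> (d \<oplus> p \<otimes> x) = mpow (Suc n) +> (d \<oplus> p \<otimes> y) \<longleftrightarrow> mpow n +> x = mpow n +> y"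
proof -
  have "d \<oplus> p \<otimes> x \<ominus> (d \<oplus> p \<otimes> y) = p \<otimes> (x \<ominus> y)"
    using assms p_closed by algebra
  then show ?thesis
    using assms p_mult_mem_iff[OF assms(1), of "x \<ominus> y"] by (simp add: coset_eq_iff)
qed

lemma coset_1_eq:
  assumes "d \<in> carrier R" "x \<in> carrier R"
  shows "\<mm> +> (d \<oplus> p \<otimes> x) = \<mm> +> d"
proof -
  have "d \<oplus> p \<otimes> x \<ominus> d = p \<otimes> x"
    using assms p_closed by algebra
  then show ?thesis
    using coset_eq_iff[of "d \<oplus> p \<otimes> x" d "Suc 0"] mem_mm_iff_mult assms
    unfolding mpow_1 by auto
qed

lemma mem_mm_iff:
  assumes "x \<in> carrier R"
  shows "x \<in> \<mm> \<longleftrightarrow> \<mm> +> x = \<mm> +> \<zero>"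
  using coset_eq_iff[of x \<zero> "Suc 0"] assms unfolding mpow_1 by (simp add: minus_eq)

definition transversal :: "nat \<Rightarrow> 'a set \<Rightarrow> bool"
  where "transversal n T \<longleftrightarrow> finite T \<and> T \<subseteq> carrier R \<and> inj_on ((+>) (mpow n)) T \<and>
    (\<forall>x\<in>carrier R. \<exists>t\<in>T. mpow n +> t = mpow n +> x)"

lemma residue_transversal:
  assumes "finite (carrier (R Quot \<mm>))"
  obtains D where "transversal (Suc 0) D" "card D = card (carrier (R Quot \<mm>))"
    "card (D - \<mm>) = card D - 1" "card D \<ge> 2"
proof -
  have Q: "carrier (R Quot \<mm>) = (+>) \<mm> ` carrier R"
    by (auto simp: FactRing_def A_RCOSETS_def')
  then obtain D where D: "D \<subseteq> carrier R" "inj_on ((+>) \<mm>) D" "carrier (R Quot \<mm>) = (+>) \<mm> ` D"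
    using subset_image_inj[of "carrier (R Quot \<mm>)" "(+>) \<mm>" "carrier R"] by auto
  have fin: "finite D" using D assms by (metis finite_imageD)
  have surj: "\<exists>t\<in>D. \<mm> +> t = \<mm> +> x" if "x \<in> carrier R" for x
    using that D(3) Q by (metis image_iff)
  have "transversal (Suc 0) D"
    unfolding transversal_def mpow_1 using D fin surj by auto
  moreover have "card D = card (carrier (R Quot \<mm>))"
    using D by (simp add: card_image)
  moreover obtain z where z: "z \<in> D" "\<mm> +> z = \<mm> +> \<zero>"
    using surj[of \<zero>] by auto
  have Dm: "D \<inter> \<mm> = {z}"
  proof (intro equalityI subsetI)
    fix x assume "x \<in> D \<inter> \<mm>"
    then have "x \<in> D" "\<mm> +> x = \<mm> +> z"
      using z D(1) mem_mm_iff[of x] by auto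
    then show "x \<in> {z}" using inj_onD[OF D(2)] z(1) by blast
  next
    fix x assume "x \<in> {z}"
    then show "x \<in> D \<inter> \<mm>" using z D(1) mem_mm_iff[of z] by auto
  qed
  then have "card (D - \<mm>) = card D - 1"
    using fin by (simp add: card_Diff_subset_Int)
  moreover obtain e where e: "e \<in> D" "\<mm> +> e = \<mm> +> \<one>"
    using surj[of \<one>] by auto
  have "e \<noteq> z"
    using e(2) z(2) mem_mm_iff[OF one_closed] one_imp_carrier I_notcarr by metis
  then have "card D \<ge> 2"
    using e z fin card_mono[of D "{e, z}"] by auto
  ultimately show ?thesis using that by blast
qed

lemma ex_transversal:
  assumes D: "transversal (Suc 0) D" "card (D - \<mm>) = card D - 1"
  shows "enat n \<le> local_length R \<mm> \<Longrightarrow>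
    \<exists>T. transversal n T \<and> card T = card D ^ n \<and>
      (n \<ge> 1 \<longrightarrow> card (T - \<mm>) = (card D - 1) * card D ^ (n - 1))"
proof (induction n)
  case 0
  have "transversal 0 {\<zero>}"
    using coset_eq_iff[of \<zero> _ 0] by (simp add: transversal_def mpow_0)
  then show ?case by (intro exI[of _ "{\<zero>}"]) simp
next
  case (Suc n)
  have "enat n \<le> local_length R \<mm>"
    by (rule order_trans[OF _ Suc.prems]) simp
  with Suc.IH obtain T where T: "transversal n T" "card T = card D ^ n" by blast
  let ?f = "\<lambda>(d, y). d \<oplus> p \<otimes> y"
  let ?S = "?f ` (D \<times> T)"
  have Dc: "d \<in> carrier R" if "d \<in> D" for d using that D by (auto simp: transversal_def)
  have Tc: "t \<in> carrier R" if "t \<in> T" for t using that T by (auto simp: transversal_def)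
  have inj: "d = d' \<and> y = y'"
    if "d \<in> D" "d' \<in> D" "y \<in> T" "y' \<in> T"
      "mpow (Suc n) +> (d \<oplus> p \<otimes> y) = mpow (Suc n) +> (d' \<oplus> p \<otimes> y')" for d d' y y'
  proof -
    have c: "d \<in> carrier R" "d' \<in> carrier R" "y \<in> carrier R" "y' \<in> carrier R"
      using that Dc Tc by auto
    have "\<mm> +> d = \<mm> +> d'"
      using coset_antimono[OF _ _ _ that(5), of "Suc 0"] c coset_1_eq unfolding mpow_1 by simp
    then have "d = d'"
      using D that(1,2) by (auto simp: transversal_def mpow_1 dest: inj_onD)
    then have "mpow n +> y = mpow n +> y'"
      using that(5) coset_Suc_eq_iff[OF Suc.prems] c by blast
    then have "y = y'"
      using T that by (auto simp: transversal_def dest: inj_onD)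
    with \<open>d = d'\<close> show ?thesis by simp
  qed
  have injf: "inj_on ?f (D \<times> T)"
  proof (rule inj_onI, clarify)
    fix d y d' y' assume "d \<in> D" "y \<in> T" "d' \<in> D" "y' \<in> T" "d \<oplus> p \<otimes> y = d' \<oplus> p \<otimes> y'"
    with inj[of d d' y y'] show "d = d' \<and> y = y'" by simp
  qed
  have surj: "\<exists>t\<in>?S. mpow (Suc n) +> t = mpow (Suc n) +> x" if x: "x \<in> carrier R" for x
  proof -
    obtain d where d: "d \<in> D" "mpow (Suc 0) +> d = mpow (Suc 0) +> x"
      using D(1) x unfolding transversal_def by blast
    then have "x \<ominus> d \<in> \<mm>" using x Dc coset_eq_iff[of x d "Suc 0"] mpow_1 by simp
    then obtain z where z: "z \<in> carrier R" "x \<ominus> d = p \<otimes> z"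
      by (auto simp: mem_mm_iff_mult)
    have "x = d \<oplus> (x \<ominus> d)" using x Dc[OF d(1)] by algebra
    with z have xe: "x = d \<oplus> p \<otimes> z" by simp
    obtain t where t: "t \<in> T" "mpow n +> t = mpow n +> z"
      using T z unfolding transversal_def by blast
    then have "mpow (Suc n) +> (d \<oplus> p \<otimes> t) = mpow (Suc n) +> x"
      unfolding xe using coset_Suc_eq_iff[OF Suc.prems] Dc d Tc z by simp
    then show ?thesis using d t by (intro bexI[of _ "d \<oplus> p \<otimes> t"]) auto
  qed
  have "transversal (Suc n) ?S"
    unfolding transversal_def
  proof (intro conjI ballI surj)
    show "finite ?S" using D T by (auto simp: transversal_def)
    show "?S \<subseteq> carrier R" using Dc Tc by auto
    show "inj_on ((+>) (mpow (Suc n))) ?S"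
      by (rule inj_onI) (auto dest: inj)
  qed
  moreover have "card ?S = card D ^ Suc n"
    using T by (simp add: card_image[OF injf] card_cartesian_product)
  moreover have "d \<oplus> p \<otimes> y \<in> \<mm> \<longleftrightarrow> d \<in> \<mm>" if "d \<in> D" "y \<in> T" for d y
    using that Dc Tc mem_mm_iff[of d] mem_mm_iff[of "d \<oplus> p \<otimes> y"] coset_1_eq[of d y] by simp
  then have "?S - \<mm> = ?f ` ((D - \<mm>) \<times> T)"
    by force
  then have "card (?S - \<mm>) = (card D - 1) * card D ^ n"
    using card_image[OF inj_on_subset[OF injf, of "(D - \<mm>) \<times> T"]] D(2) T(2)
    by (auto simp: card_cartesian_product)
  ultimately show ?case by (intro exI[of _ ?S]) auto
qed

end

section \<open>Similarity modulo a power of the maximal ideal\<close>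

context uniformized_ring
begin

definition mred :: "nat \<Rightarrow> 'a mat2 \<Rightarrow> 'a set mat2"
  where "mred n = (\<lambda>(a, b, c, d). (mpow n +> a, mpow n +> b, mpow n +> c, mpow n +> d))"

lemma mred_simp [simp]:
  "mred n (a, b, c, d) = (mpow n +> a, mpow n +> b, mpow n +> c, mpow n +> d)"
  by (simp add: mred_def)

lemma quot_hom: "ring_hom_cring R (R Quot mpow n) ((+>) (mpow n))"
  by (intro ideal.rcos_ring_hom_cring mpow_ideal is_cring)

lemma carrier_quot: "carrier (R Quot mpow n) = (+>) (mpow n) ` carrier R"
  by (auto simp: FactRing_def A_RCOSETS_def')

lemma mred_image: "mred n ` carrier (M2 R) = carrier (M2 (R Quot mpow n))"
proof
  show "mred n ` carrier (M2 R) \<subseteq> carrier (M2 (R Quot mpow n))"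
    by (auto simp: carrier_quot)
  show "carrier (M2 (R Quot mpow n)) \<subseteq> mred n ` carrier (M2 R)"
  proof
    fix Y assume "Y \<in> carrier (M2 (R Quot mpow n))"
    then obtain a b c d where "Y = mred n (a, b, c, d)" "(a, b, c, d) \<in> carrier (M2 R)"
      by (auto simp: carrier_quot)
    then show "Y \<in> mred n ` carrier (M2 R)" by blast
  qed
qed

lemma mred_mult:
  assumes "X \<in> carrier (M2 R)" "Y \<in> carrier (M2 R)"
  shows "mred n (X \<otimes>\<^bsub>M2 R\<^esub> Y) = mred n X \<otimes>\<^bsub>M2 (R Quot mpow n)\<^esub> mred n Y"
proof -
  interpret h: ring_hom_cring R "R Quot mpow n" "(+>) (mpow n)" by (rule quot_hom)
  show ?thesis using assms by (auto simp: h.hom_mult h.hom_add)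
qed

lemma mdet_mred:
  assumes "X \<in> carrier (M2 R)"
  shows "mdet (R Quot mpow n) (mred n X) = mpow n +> mdet R X"
proof -
  interpret h: ring_hom_cring R "R Quot mpow n" "(+>) (mpow n)" by (rule quot_hom)
  show ?thesis using assms by (auto simp: mdet_def minus_eq h.S.minus_eq)
qed

lemma mtrace_mred:
  assumes "X \<in> carrier (M2 R)"
  shows "mtrace (R Quot mpow n) (mred n X) = mpow n +> mtrace R X"
proof -
  interpret h: ring_hom_cring R "R Quot mpow n" "(+>) (mpow n)" by (rule quot_hom)
  show ?thesis using assms by (auto simp: mtrace_def)
qed

lemma Units_quot_iff:
  assumes "1 \<le> n" "x \<in> carrier R"
  shows "mpow n +> x \<in> Units (R Quot mpow n) \<longleftrightarrow> x \<notin> \<mm>"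
proof -
  interpret h: ring_hom_cring R "R Quot mpow n" "(+>) (mpow n)" by (rule quot_hom)
  show ?thesis
  proof
    assume "mpow n +> x \<in> Units (R Quot mpow n)"
    then obtain y where y: "y \<in> carrier R" "mpow n +> (x \<otimes> y) = mpow n +> \<one>"
      using assms(2) by (auto simp: Units_def carrier_quot h.hom_mult)
    show "x \<notin> \<mm>"
    proof
      assume x: "x \<in> \<mm>"
      have "\<mm> +> (x \<otimes> y) = \<mm> +> \<one>"
        using coset_antimono[OF _ _ assms(1) y(2)] assms(2) y(1) by (simp add: mpow_1)
      moreover have "x \<otimes> y \<in> \<mm>" using x y(1) I_r_closed by blast
      ultimately have "\<one> \<in> \<mm>"
        using mem_mm_iff[of "x \<otimes> y"] mem_mm_iff[of \<one>] assms(2) y(1) by simp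
      then show False using I_notcarr one_imp_carrier by blast
    qed
  next
    assume "x \<notin> \<mm>"
    then have "x \<in> Units R" using assms(2) Units_iff by blast
    then have "x \<otimes> inv x = \<one>" "inv x \<in> carrier R" by auto
    then show "mpow n +> x \<in> Units (R Quot mpow n)"
      using assms(2) by (metis h.S.Units_one_closed h.S.unit_factor h.hom_closed h.hom_mult h.hom_one)
  qed
qed

lemma GL2_quot_iff:
  assumes "1 \<le> n" "X \<in> carrier (M2 R)"
  shows "mred n X \<in> GL2 (R Quot mpow n) \<longleftrightarrow> mdet R X \<notin> \<mm>"
proof -
  interpret h: ring_hom_cring R "R Quot mpow n" "(+>) (mpow n)" by (rule quot_hom)
  have "mred n X \<in> carrier (M2 (R Quot mpow n))"
    using assms(2) mred_image by blast
  then show ?thesis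
    using h.S.GL2_iff mdet_mred[OF assms(2)] Units_quot_iff[OF assms(1) mdet_closed[OF assms(2)]] by simp
qed

text \<open>For \<open>n = 0\<close> the quotient is the zero ring, yet the conjugating matrix is still required
  to be invertible modulo \<open>\<mm>\<close>; this makes the step from \<open>n\<close> to \<open>Suc n\<close> uniform.\<close>

definition msim :: "nat \<Rightarrow> 'a mat2 \<Rightarrow> 'a mat2 \<Rightarrow> bool"
  where "msim n \<alpha> \<alpha>' \<longleftrightarrow> (\<exists>X\<in>carrier (M2 R). mdet R X \<notin> \<mm> \<and>
    mred n (X \<otimes>\<^bsub>M2 R\<^esub> \<alpha>) = mred n (\<alpha>' \<otimes>\<^bsub>M2 R\<^esub> X))"

lemma msim_iff_similar_mat2:
  assumes n: "1 \<le> n" and a: "\<alpha> \<in> carrier (M2 R)" "\<alpha>' \<in> carrier (M2 R)"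
  shows "msim n \<alpha> \<alpha>' \<longleftrightarrow> similar_mat2 (R Quot mpow n) (mred n \<alpha>) (mred n \<alpha>')"
proof
  assume "msim n \<alpha> \<alpha>'"
  then obtain X where X: "X \<in> carrier (M2 R)" "mdet R X \<notin> \<mm>"
    "mred n (X \<otimes>\<^bsub>M2 R\<^esub> \<alpha>) = mred n (\<alpha>' \<otimes>\<^bsub>M2 R\<^esub> X)"
    unfolding msim_def by blast
  then have "mred n X \<in> GL2 (R Quot mpow n)" using GL2_quot_iff[OF n] by blast
  moreover have "mred n X \<otimes>\<^bsub>M2 (R Quot mpow n)\<^esub> mred n \<alpha> = mred n \<alpha>' \<otimes>\<^bsub>M2 (R Quot mpow n)\<^esub> mred n X"
    using X(3) mred_mult[OF X(1) a(1)] mred_mult[OF a(2) X(1)] by simp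
  ultimately show "similar_mat2 (R Quot mpow n) (mred n \<alpha>) (mred n \<alpha>')"
    unfolding similar_mat2_def by blast
next
  assume "similar_mat2 (R Quot mpow n) (mred n \<alpha>) (mred n \<alpha>')"
  then obtain Y where Y: "Y \<in> GL2 (R Quot mpow n)"
    "Y \<otimes>\<^bsub>M2 (R Quot mpow n)\<^esub> mred n \<alpha> = mred n \<alpha>' \<otimes>\<^bsub>M2 (R Quot mpow n)\<^esub> Y"
    unfolding similar_mat2_def by blast
  then have "Y \<in> mred n ` carrier (M2 R)"
    unfolding mred_image Units_def by blast
  then obtain X where X: "X \<in> carrier (M2 R)" "Y = mred n X" by blast
  then have "mdet R X \<notin> \<mm>" using Y(1) GL2_quot_iff[OF n] by blast
  moreover have "mred n (X \<otimes>\<^bsub>M2 R\<^esub> \<alpha>) = mred n (\<alpha>' \<otimes>\<^bsub>M2 R\<^esub> X)"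
    using Y(2) X(2) mred_mult[OF X(1) a(1)] mred_mult[OF a(2) X(1)] by simp
  ultimately show "msim n \<alpha> \<alpha>'" using X(1) unfolding msim_def by blast
qed

lemma mred_antimono:
  assumes "X \<in> carrier (M2 R)" "Y \<in> carrier (M2 R)" "m \<le> n" "mred n X = mred n Y"
  shows "mred m X = mred m Y"
  using assms(1,2,4) by clarsimp (meson coset_antimono[OF _ _ assms(3)])

lemma msim_antimono:
  assumes "\<alpha> \<in> carrier (M2 R)" "\<alpha>' \<in> carrier (M2 R)" "m \<le> n" "msim n \<alpha> \<alpha>'"
  shows "msim m \<alpha> \<alpha>'"
proof -
  interpret M: ring "M2 R" by (rule M2_ring)
  show ?thesis
    using assms mred_antimono[OF M.m_closed M.m_closed] unfolding msim_def by meson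
qed

definition shift :: "'a \<Rightarrow> 'a mat2 \<Rightarrow> 'a mat2"
  where "shift d = (\<lambda>(a, b, c, e). (d \<oplus> p \<otimes> a, p \<otimes> b, p \<otimes> c, d \<oplus> p \<otimes> e))"

definition companion :: "'a \<Rightarrow> 'a \<Rightarrow> 'a mat2"
  where "companion t e = (\<zero>, \<one>, \<ominus> e, t)"

lemma shift_closed: "d \<in> carrier R \<Longrightarrow> \<beta> \<in> carrier (M2 R) \<Longrightarrow> shift d \<beta> \<in> carrier (M2 R)"
  by (auto simp: shift_def)

lemma companion_closed: "t \<in> carrier R \<Longrightarrow> e \<in> carrier R \<Longrightarrow> companion t e \<in> carrier (M2 R)"
  by (simp add: companion_def)

lemma mdet_companion: "e \<in> carrier R \<Longrightarrow> t \<in> carrier R \<Longrightarrow> mdet R (companion t e) = e"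
  by (simp add: mdet_def companion_def minus_eq)

lemma mtrace_companion: "t \<in> carrier R \<Longrightarrow> mtrace R (companion t e) = t"
  by (simp add: mtrace_def companion_def)

lemma mdet_shift_mem_iff:
  assumes "d \<in> carrier R" "\<beta> \<in> carrier (M2 R)"
  shows "mdet R (shift d \<beta>) \<in> \<mm> \<longleftrightarrow> d \<in> \<mm>"
proof -
  obtain a b c e where \<beta>: "\<beta> = (a, b, c, e)" by (metis prod_cases4)
  have c: "a \<in> carrier R" "b \<in> carrier R" "c \<in> carrier R" "e \<in> carrier R"
    using assms \<beta> by auto
  let ?z = "d \<otimes> (a \<oplus> e) \<oplus> p \<otimes> (a \<otimes> e \<ominus> b \<otimes> c)"
  have "(d \<oplus> p \<otimes> a) \<otimes> (d \<oplus> p \<otimes> e) \<ominus> p \<otimes> b \<otimes> (p \<otimes> c) = d \<otimes> d \<oplus> p \<otimes> ?z"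
    using c assms(1) p_closed by algebra
  then have "mdet R (shift d \<beta>) = d \<otimes> d \<oplus> p \<otimes> ?z"
    by (simp add: mdet_def shift_def \<beta>)
  then have "\<mm> +> mdet R (shift d \<beta>) = \<mm> +> (d \<otimes> d)"
    using coset_1_eq[of "d \<otimes> d" ?z] c assms(1) by simp
  then show ?thesis
    using mem_mm_iff mdet_closed[OF shift_closed[OF assms]] mm_prime assms(1)
    by (metis m_closed)
qed

lemma mred_shift_eq_iff:
  assumes n: "enat (Suc n) \<le> local_length R \<mm>" and d: "d \<in> carrier R"
    and X: "X \<in> carrier (M2 R)" and b: "\<beta> \<in> carrier (M2 R)" "\<beta>' \<in> carrier (M2 R)"
  shows "mred (Suc n) (X \<otimes>\<^bsub>M2 R\<^esub> shift d \<beta>) = mred (Suc n) (shift d \<beta>' \<otimes>\<^bsub>M2 R\<^esub> X) \<longleftrightarrow>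
    mred n (X \<otimes>\<^bsub>M2 R\<^esub> \<beta>) = mred n (\<beta>' \<otimes>\<^bsub>M2 R\<^esub> X)"
proof -
  obtain x1 x2 x3 x4 where XX: "X = (x1, x2, x3, x4)" by (metis prod_cases4)
  obtain b1 b2 b3 b4 where B: "\<beta> = (b1, b2, b3, b4)" by (metis prod_cases4)
  obtain c1 c2 c3 c4 where C: "\<beta>' = (c1, c2, c3, c4)" by (metis prod_cases4)
  have c: "x1 \<in> carrier R" "x2 \<in> carrier R" "x3 \<in> carrier R" "x4 \<in> carrier R"
    "b1 \<in> carrier R" "b2 \<in> carrier R" "b3 \<in> carrier R" "b4 \<in> carrier R"
    "c1 \<in> carrier R" "c2 \<in> carrier R" "c3 \<in> carrier R" "c4 \<in> carrier R"
    using X b XX B C by auto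
  have l: "x \<otimes> (d \<oplus> p \<otimes> y) \<oplus> x' \<otimes> (p \<otimes> y') = d \<otimes> x \<oplus> p \<otimes> (x \<otimes> y \<oplus> x' \<otimes> y')"
    "x' \<otimes> (p \<otimes> y') \<oplus> x \<otimes> (d \<oplus> p \<otimes> y) = d \<otimes> x \<oplus> p \<otimes> (x' \<otimes> y' \<oplus> x \<otimes> y)"
    "(d \<oplus> p \<otimes> y) \<otimes> x \<oplus> (p \<otimes> y') \<otimes> x' = d \<otimes> x \<oplus> p \<otimes> (y \<otimes> x \<oplus> y' \<otimes> x')"
    "(p \<otimes> y') \<otimes> x' \<oplus> (d \<oplus> p \<otimes> y) \<otimes> x = d \<otimes> x \<oplus> p \<otimes> (y' \<otimes> x' \<oplus> y \<otimes> x)"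
    if "x \<in> carrier R" "x' \<in> carrier R" "y \<in> carrier R" "y' \<in> carrier R" for x x' y y'
    using that d p_closed by algebra+
  show ?thesis
    unfolding XX B C shift_def
    by (simp add: l c d coset_Suc_eq_iff[OF n])
qed

lemma msim_shift_iff:
  assumes "enat (Suc n) \<le> local_length R \<mm>" "d \<in> carrier R"
    and "\<beta> \<in> carrier (M2 R)" "\<beta>' \<in> carrier (M2 R)"
  shows "msim (Suc n) (shift d \<beta>) (shift d \<beta>') \<longleftrightarrow> msim n \<beta> \<beta>'"
  unfolding msim_def using mred_shift_eq_iff[OF assms(1,2) _ assms(3,4)] by blast

lemma mred_1_shift:
  assumes "d \<in> carrier R" "\<beta> \<in> carrier (M2 R)"
  shows "mred (Suc 0) (shift d \<beta>) =
    (\<mm> +> d, \<zero>\<^bsub>R Quot \<mm>\<^esub>, \<zero>\<^bsub>R Quot \<mm>\<^esub>, \<mm> +> d)"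
proof -
  interpret h: ring_hom_cring R "R Quot mpow (Suc 0)" "(+>) (mpow (Suc 0))" by (rule quot_hom)
  have z: "\<mm> +> p \<otimes> x = \<zero>\<^bsub>R Quot \<mm>\<^esub>" if "x \<in> carrier R" for x
    using coset_1_eq[of \<zero> x] that h.hom_zero by (simp add: mpow_1)
  show ?thesis
    using assms by (auto simp: shift_def mpow_1 coset_1_eq z)
qed

lemma msim_scalar_mod:
  assumes "\<alpha> \<in> carrier (M2 R)" "d \<in> carrier R" "\<beta> \<in> carrier (M2 R)"
    and "msim (Suc n) \<alpha> (shift d \<beta>) \<or> msim (Suc n) (shift d \<beta>) \<alpha>"
  shows "mred (Suc 0) \<alpha> = (\<mm> +> d, \<zero>\<^bsub>R Quot \<mm>\<^esub>, \<zero>\<^bsub>R Quot \<mm>\<^esub>, \<mm> +> d)"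
proof -
  interpret h: ring_hom_cring R "R Quot \<mm>" "(+>) \<mm>"
    using quot_hom[of "Suc 0"] by (simp add: mpow_1)
  have s: "shift d \<beta> \<in> carrier (M2 R)" using assms shift_closed by blast
  have "msim (Suc 0) \<alpha> (shift d \<beta>) \<or> msim (Suc 0) (shift d \<beta>) \<alpha>"
    using assms(1,4) s msim_antimono[of _ _ "Suc 0" "Suc n"] by auto
  then have "similar_mat2 (R Quot \<mm>) (mred (Suc 0) \<alpha>) (mred (Suc 0) (shift d \<beta>)) \<or>
    similar_mat2 (R Quot \<mm>) (mred (Suc 0) (shift d \<beta>)) (mred (Suc 0) \<alpha>)"
    using msim_iff_similar_mat2[of "Suc 0"] assms(1) s unfolding mpow_1 by auto
  moreover have "mred (Suc 0) \<alpha> \<in> carrier (M2 (R Quot \<mm>))"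
    using mred_image[of "Suc 0"] assms(1) unfolding mpow_1 by blast
  ultimately show ?thesis
    unfolding mred_1_shift[OF assms(2,3)]
    using h.S.similar_mat2_scalar[of "\<mm> +> d"] assms(2) by blast
qed

lemma not_msim_companion_shift:
  assumes "t \<in> carrier R" "e \<in> carrier R" "d \<in> carrier R" "\<beta> \<in> carrier (M2 R)"
  shows "\<not> msim (Suc n) (companion t e) (shift d \<beta>)" "\<not> msim (Suc n) (shift d \<beta>) (companion t e)"
proof -
  interpret h: ring_hom_cring R "R Quot \<mm>" "(+>) \<mm>"
    using quot_hom[of "Suc 0"] by (simp add: mpow_1)
  have "\<mm> +> \<one> \<noteq> \<zero>\<^bsub>R Quot \<mm>\<^esub>"
    using mem_mm_iff[of \<one>] one_imp_carrier I_notcarr h.hom_zero by auto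
  then have "mred (Suc 0) (companion t e) \<noteq> (\<mm> +> d, \<zero>\<^bsub>R Quot \<mm>\<^esub>, \<zero>\<^bsub>R Quot \<mm>\<^esub>, \<mm> +> d)"
    unfolding companion_def mred_simp mpow_1 by blast
  then show "\<not> msim (Suc n) (companion t e) (shift d \<beta>)" "\<not> msim (Suc n) (shift d \<beta>) (companion t e)"
    using msim_scalar_mod[OF companion_closed assms(3,4)] assms(1,2) by blast+
qed

lemma msim_shift_coset_eq:
  assumes "d \<in> carrier R" "\<beta> \<in> carrier (M2 R)" "d' \<in> carrier R" "\<beta>' \<in> carrier (M2 R)"
    and "msim (Suc n) (shift d \<beta>) (shift d' \<beta>')"
  shows "\<mm> +> d = \<mm> +> d'"
  using msim_scalar_mod[OF shift_closed[OF assms(1,2)] assms(3,4)] assms(5)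
    mred_1_shift[OF assms(1,2)] by auto

lemma msim_invariants:
  assumes "1 \<le> n" "\<alpha> \<in> carrier (M2 R)" "\<alpha>' \<in> carrier (M2 R)" "msim n \<alpha> \<alpha>'"
  shows "mpow n +> mdet R \<alpha> = mpow n +> mdet R \<alpha>'" "mpow n +> mtrace R \<alpha> = mpow n +> mtrace R \<alpha>'"
proof -
  interpret h: ring_hom_cring R "R Quot mpow n" "(+>) (mpow n)" by (rule quot_hom)
  have c: "mred n \<alpha> \<in> carrier (M2 (R Quot mpow n))" "mred n \<alpha>' \<in> carrier (M2 (R Quot mpow n))"
    using assms mred_image by blast+
  have "similar_mat2 (R Quot mpow n) (mred n \<alpha>) (mred n \<alpha>')"
    using assms msim_iff_similar_mat2 by blast
  from h.S.similar_mat2_invariants[OF c this]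
  show "mpow n +> mdet R \<alpha> = mpow n +> mdet R \<alpha>'" "mpow n +> mtrace R \<alpha> = mpow n +> mtrace R \<alpha>'"
    using mdet_mred mtrace_mred assms by simp_all
qed

lemma cyclic_vector:
  assumes "(a, b, c, d) \<in> carrier (M2 R)" "x \<in> carrier R" "y \<in> carrier R"
  defines "X \<equiv> (x, y, x \<otimes> a \<oplus> y \<otimes> c, x \<otimes> b \<oplus> y \<otimes> d)"
  shows "X \<otimes>\<^bsub>M2 R\<^esub> (a, b, c, d) = companion (a \<oplus> d) (a \<otimes> d \<ominus> b \<otimes> c) \<otimes>\<^bsub>M2 R\<^esub> X"
proof -
  have c: "a \<in> carrier R" "b \<in> carrier R" "c \<in> carrier R" "d \<in> carrier R"
    using assms by auto
  have "(x \<otimes> a \<oplus> y \<otimes> c) \<otimes> a \<oplus> (x \<otimes> b \<oplus> y \<otimes> d) \<otimes> c =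
      \<ominus> (a \<otimes> d \<ominus> b \<otimes> c) \<otimes> x \<oplus> (a \<oplus> d) \<otimes> (x \<otimes> a \<oplus> y \<otimes> c)"
    "(x \<otimes> a \<oplus> y \<otimes> c) \<otimes> b \<oplus> (x \<otimes> b \<oplus> y \<otimes> d) \<otimes> d =
      \<ominus> (a \<otimes> d \<ominus> b \<otimes> c) \<otimes> y \<oplus> (a \<oplus> d) \<otimes> (x \<otimes> b \<oplus> y \<otimes> d)"
    using c assms(2,3) by algebra+
  then show ?thesis
    using c assms(2,3) by (simp add: X_def companion_def)
qed

lemma cyclic_or_scalar_mod_cases:
  assumes "\<alpha> \<in> carrier (M2 R)"
  obtains X where "X \<in> carrier (M2 R)" "mdet R X \<notin> \<mm>"
      "X \<otimes>\<^bsub>M2 R\<^esub> \<alpha> = companion (mtrace R \<alpha>) (mdet R \<alpha>) \<otimes>\<^bsub>M2 R\<^esub> X"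
  | a b c d where "\<alpha> = (a, b, c, d)" "b \<in> \<mm>" "c \<in> \<mm>" "a \<ominus> d \<in> \<mm>"
proof -
  obtain a b c d where \<alpha>: "\<alpha> = (a, b, c, d)" by (metis prod_cases4)
  have c: "a \<in> carrier R" "b \<in> carrier R" "c \<in> carrier R" "d \<in> carrier R"
    using assms \<alpha> by auto
  note companion_case = that(1) and shift_case = that(2)
  \<comment> \<open>The vector \<open>(x, y)\<close> is cyclic for \<open>\<alpha>\<close>; one of \<open>(1, 0)\<close>, \<open>(0, 1)\<close>, \<open>(1, 1)\<close> always works.\<close>
  have cyclic: thesis if xy: "x \<in> carrier R" "y \<in> carrier R"
    "x \<otimes> (x \<otimes> b \<oplus> y \<otimes> d) \<ominus> y \<otimes> (x \<otimes> a \<oplus> y \<otimes> c) \<notin> \<mm>" for x y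
  proof (rule companion_case)
    let ?X = "(x, y, x \<otimes> a \<oplus> y \<otimes> c, x \<otimes> b \<oplus> y \<otimes> d)"
    show "?X \<in> carrier (M2 R)" using c xy by simp
    show "mdet R ?X \<notin> \<mm>" using xy(3) by (simp add: mdet_def)
    show "?X \<otimes>\<^bsub>M2 R\<^esub> \<alpha> = companion (mtrace R \<alpha>) (mdet R \<alpha>) \<otimes>\<^bsub>M2 R\<^esub> ?X"
      unfolding \<alpha> mtrace_def mdet_def prod.case
      using assms xy(1,2) by (intro cyclic_vector) (simp_all add: \<alpha>)
  qed
  show thesis
  proof (cases "b \<in> \<mm> \<and> c \<in> \<mm> \<and> a \<ominus> d \<in> \<mm>")
    case True
    then show ?thesis using shift_case \<alpha> by blast
  next
    case False
    then consider "b \<notin> \<mm>" | "c \<notin> \<mm>" | "b \<in> \<mm>" "c \<in> \<mm>" "a \<ominus> d \<notin> \<mm>" by blast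
    then show ?thesis
    proof cases
      case 1
      have "\<one> \<otimes> (\<one> \<otimes> b \<oplus> \<zero> \<otimes> d) \<ominus> \<zero> \<otimes> (\<one> \<otimes> a \<oplus> \<zero> \<otimes> c) = b"
        using c by (simp add: minus_eq)
      then show ?thesis using cyclic[of \<one> \<zero>] 1 by simp
    next
      case 2
      have e: "\<zero> \<otimes> (\<zero> \<otimes> b \<oplus> \<one> \<otimes> d) \<ominus> \<one> \<otimes> (\<zero> \<otimes> a \<oplus> \<one> \<otimes> c) = \<ominus> c"
        using c by (simp add: minus_eq)
      have "\<ominus> c \<notin> \<mm>" using 2 c a_inv_closed[of "\<ominus> c"] by auto
      then show ?thesis using cyclic[of \<zero> \<one>] e by simp
    next
      case 3
      let ?z = "\<one> \<otimes> (\<one> \<otimes> b \<oplus> \<one> \<otimes> d) \<ominus> \<one> \<otimes> (\<one> \<otimes> a \<oplus> \<one> \<otimes> c)"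
      have e: "a \<ominus> d = b \<ominus> c \<ominus> ?z"
        using c by simp algebra
      have "?z \<notin> \<mm>"
      proof
        assume "?z \<in> \<mm>"
        from a_closed[OF a_closed[OF 3(1) a_inv_closed[OF 3(2)]] a_inv_closed[OF this]]
        have "b \<ominus> c \<ominus> ?z \<in> \<mm>" by (simp only: minus_eq)
        then show False using 3(3) e by simp
      qed
      then show ?thesis using cyclic[of \<one> \<one>] by simp
    qed
  qed
qed

end

section \<open>Counting classes\<close>

lemma card_quotient_transversal:
  assumes "equiv S E" "inj_on f T" "f ` T \<subseteq> S"
    and "\<And>x y. \<lbrakk>x \<in> T; y \<in> T; (f x, f y) \<in> E\<rbrakk> \<Longrightarrow> x = y"
    and "\<And>s. s \<in> S \<Longrightarrow> \<exists>t\<in>T. (s, f t) \<in> E"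
  shows "card (S // E) = card T"
proof -
  have "S // E = (\<lambda>t. E `` {f t}) ` T"
  proof (intro equalityI subsetI)
    fix C assume "C \<in> S // E"
    then obtain s where s: "s \<in> S" "C = E `` {s}" by (rule quotientE)
    then obtain t where "t \<in> T" "(s, f t) \<in> E" using assms(5) by blast
    then show "C \<in> (\<lambda>t. E `` {f t}) ` T"
      using equiv_class_eq[OF assms(1)] s(2) by blast
  next
    fix C assume "C \<in> (\<lambda>t. E `` {f t}) ` T"
    then show "C \<in> S // E" using assms(3) by (auto intro: quotientI)
  qed
  moreover have "inj_on (\<lambda>t. E `` {f t}) T"
  proof (rule inj_onI)
    fix x y assume "x \<in> T" "y \<in> T" "E `` {f x} = E `` {f y}"
    then show "x = y"
      using eq_equiv_class[OF _ assms(1)] assms(3,4) by blast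
  qed
  ultimately show ?thesis by (simp add: card_image)
qed

context uniformized_ring
begin

definition mat_transversal :: "nat \<Rightarrow> 'a mat2 set \<Rightarrow> bool"
  where "mat_transversal n T \<longleftrightarrow> finite T \<and> T \<subseteq> carrier (M2 R) \<and>
    (\<forall>\<alpha>\<in>T. \<forall>\<alpha>'\<in>T. msim n \<alpha> \<alpha>' \<longrightarrow> \<alpha> = \<alpha>') \<and>
    (\<forall>\<alpha>\<in>carrier (M2 R). \<exists>t\<in>T. msim n \<alpha> t)"

lemma mat_transversal_Suc:
  assumes n: "enat (Suc n) \<le> local_length R \<mm>"
    and D: "transversal (Suc 0) D" and A: "transversal (Suc n) A" and T: "mat_transversal n T"
  shows "mat_transversal (Suc n)
    ((\<lambda>(t, e). companion t e) ` (A \<times> A) \<union> (\<lambda>(d, \<beta>). shift d \<beta>) ` (D \<times> T))"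
    (is "mat_transversal _ (?C \<union> ?S)")
proof -
  have Dc: "d \<in> carrier R" if "d \<in> D" for d using that D by (auto simp: transversal_def)
  have Ac: "t \<in> carrier R" if "t \<in> A" for t using that A by (auto simp: transversal_def)
  have Tc: "\<beta> \<in> carrier (M2 R)" if "\<beta> \<in> T" for \<beta>
    using that T by (auto simp: mat_transversal_def simp del: carrier_M2)
  have CC: "companion t e = companion t' e'"
    if "t \<in> A" "e \<in> A" "t' \<in> A" "e' \<in> A" "msim (Suc n) (companion t e) (companion t' e')" for t e t' e'
  proof -
    have "mpow (Suc n) +> e = mpow (Suc n) +> e'" "mpow (Suc n) +> t = mpow (Suc n) +> t'"
      using msim_invariants[OF _ _ _ that(5)] that(1-4) Ac
      by (simp_all add: companion_closed mdet_companion mtrace_companion del: carrier_M2)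
    then have "e = e'" "t = t'"
      using A that by (auto simp: transversal_def dest: inj_onD)
    then show ?thesis by simp
  qed
  have SS: "d = d' \<and> \<beta> = \<beta>'"
    if "d \<in> D" "\<beta> \<in> T" "d' \<in> D" "\<beta>' \<in> T" "msim (Suc n) (shift d \<beta>) (shift d' \<beta>')" for d \<beta> d' \<beta>'
  proof -
    have "\<mm> +> d = \<mm> +> d'"
      using msim_shift_coset_eq[OF Dc Tc Dc Tc] that by blast
    then have d: "d = d'"
      using D that by (auto simp: transversal_def mpow_1 dest: inj_onD)
    then have "msim n \<beta> \<beta>'"
      using msim_shift_iff[OF n] that Dc Tc by blast
    then show ?thesis using T that d by (auto simp: mat_transversal_def)
  qed
  have inj: "\<alpha> = \<alpha>'" if "\<alpha> \<in> ?C \<union> ?S" "\<alpha>' \<in> ?C \<union> ?S" and s: "msim (Suc n) \<alpha> \<alpha>'" for \<alpha> \<alpha>'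
    using that(1)
  proof
    assume "\<alpha> \<in> ?C"
    then obtain t e where te: "t \<in> A" "e \<in> A" "\<alpha> = companion t e" by auto
    from that(2) show ?thesis
    proof
      assume "\<alpha>' \<in> ?C"
      then show ?thesis using te s CC by auto
    next
      assume "\<alpha>' \<in> ?S"
      then obtain d \<beta> where db: "d \<in> D" "\<beta> \<in> T" "\<alpha>' = shift d \<beta>" by auto
      then show ?thesis
        using te s not_msim_companion_shift(1)[OF Ac Ac Dc Tc] by blast
    qed
  next
    assume "\<alpha> \<in> ?S"
    then obtain d \<beta> where db: "d \<in> D" "\<beta> \<in> T" "\<alpha> = shift d \<beta>" by auto
    from that(2) show ?thesis
    proof
      assume "\<alpha>' \<in> ?C"
      then obtain t e where "t \<in> A" "e \<in> A" "\<alpha>' = companion t e" by auto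
      then show ?thesis
        using db s not_msim_companion_shift(2)[OF Ac Ac Dc Tc] by blast
    next
      assume "\<alpha>' \<in> ?S"
      then obtain d' \<beta>' where "d' \<in> D" "\<beta>' \<in> T" "\<alpha>' = shift d' \<beta>'" by auto
      then show ?thesis using db s SS by blast
    qed
  qed
  have surj: "\<exists>t\<in>?C \<union> ?S. msim (Suc n) \<alpha> t" if \<alpha>: "\<alpha> \<in> carrier (M2 R)" for \<alpha>
  proof (rule cyclic_or_scalar_mod_cases[OF \<alpha>])
    fix X assume X: "X \<in> carrier (M2 R)" "mdet R X \<notin> \<mm>"
      "X \<otimes>\<^bsub>M2 R\<^esub> \<alpha> = companion (mtrace R \<alpha>) (mdet R \<alpha>) \<otimes>\<^bsub>M2 R\<^esub> X"
    obtain t e where te: "t \<in> A" "e \<in> A" "mpow (Suc n) +> t = mpow (Suc n) +> mtrace R \<alpha>"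
      "mpow (Suc n) +> e = mpow (Suc n) +> mdet R \<alpha>"
      using A mtrace_closed[OF \<alpha>] mdet_closed[OF \<alpha>] unfolding transversal_def by meson
    interpret h: ring_hom_cring R "R Quot mpow (Suc n)" "(+>) (mpow (Suc n))" by (rule quot_hom)
    have c: "companion t e \<in> carrier (M2 R)" "companion (mtrace R \<alpha>) (mdet R \<alpha>) \<in> carrier (M2 R)"
      using te(1,2) Ac companion_closed mtrace_closed[OF \<alpha>] mdet_closed[OF \<alpha>] by blast+
    have "mred (Suc n) (companion t e) = mred (Suc n) (companion (mtrace R \<alpha>) (mdet R \<alpha>))"
      using te Ac mdet_closed[OF \<alpha>] by (simp add: companion_def)
    then have "mred (Suc n) (X \<otimes>\<^bsub>M2 R\<^esub> \<alpha>) = mred (Suc n) (companion t e \<otimes>\<^bsub>M2 R\<^esub> X)"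
      unfolding X(3) mred_mult[OF c(1) X(1)] mred_mult[OF c(2) X(1)] by simp
    then have "msim (Suc n) \<alpha> (companion t e)"
      using X(1,2) unfolding msim_def by blast
    then show ?thesis using te(1,2) by blast
  next
    fix a b c e assume abc: "\<alpha> = (a, b, c, e)" "b \<in> \<mm>" "c \<in> \<mm>" "a \<ominus> e \<in> \<mm>"
    have ac: "a \<in> carrier R" "e \<in> carrier R" using \<alpha> abc(1) by auto
    obtain d where d: "d \<in> D" "\<mm> +> d = \<mm> +> a"
      using D ac(1) unfolding transversal_def mpow_1 by blast
    note dc = Dc[OF d(1)]
    have "\<mm> +> a = \<mm> +> e"
      using coset_eq_iff[OF ac, of "Suc 0"] abc(4) by (simp add: mpow_1)
    then have "a \<ominus> d \<in> \<mm>" "e \<ominus> d \<in> \<mm>"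
      using coset_eq_iff[OF ac(1) dc, of "Suc 0"] coset_eq_iff[OF ac(2) dc, of "Suc 0"] d(2)
      unfolding mpow_1 by metis+
    then obtain a' b' c' e' where p: "a' \<in> carrier R" "b' \<in> carrier R" "c' \<in> carrier R" "e' \<in> carrier R"
      "a \<ominus> d = p \<otimes> a'" "b = p \<otimes> b'" "c = p \<otimes> c'" "e \<ominus> d = p \<otimes> e'"
      using abc(2,3) unfolding mem_mm_iff_mult by blast
    have "a = d \<oplus> (a \<ominus> d)" "e = d \<oplus> (e \<ominus> d)"
      using ac dc by algebra+
    then have \<alpha>s: "\<alpha> = shift d (a', b', c', e')"
      using p by (simp add: abc(1) shift_def)
    have \<beta>: "(a', b', c', e') \<in> carrier (M2 R)" using p by simp
    then obtain t where t: "t \<in> T" "msim n (a', b', c', e') t"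
      using T unfolding mat_transversal_def by blast
    then have "msim (Suc n) \<alpha> (shift d t)"
      unfolding \<alpha>s using msim_shift_iff[OF n dc \<beta> Tc] by blast
    then show ?thesis using d(1) t(1) by blast
  qed
  show ?thesis
    unfolding mat_transversal_def
  proof (intro conjI ballI impI)
    show "finite (?C \<union> ?S)"
      using A D T by (auto simp: transversal_def mat_transversal_def)
    show "?C \<union> ?S \<subseteq> carrier (M2 R)"
      using companion_closed[OF Ac Ac] shift_closed[OF Dc Tc] by (auto simp del: carrier_M2)
  qed (fact inj surj)+
qed

lemma card_companion_shift:
  assumes n: "enat (Suc n) \<le> local_length R \<mm>"
    and D: "transversal (Suc 0) D" and A: "transversal (Suc n) A" and T: "mat_transversal n T"
  defines "U \<equiv> (\<lambda>(t, e). companion t e) ` (A \<times> A) \<union> (\<lambda>(d, \<beta>). shift d \<beta>) ` (D \<times> T)"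
  shows "card U = card A * card A + card D * card T"
    and "card {\<alpha>\<in>U. mdet R \<alpha> \<notin> \<mm>} = card A * card (A - \<mm>) + card (D - \<mm>) * card T"
proof -
  interpret M: ring "M2 R" by (rule M2_ring)
  have Dc: "d \<in> carrier R" if "d \<in> D" for d using that D by (auto simp: transversal_def)
  have Ac: "t \<in> carrier R" if "t \<in> A" for t using that A by (auto simp: transversal_def)
  have Tc: "\<beta> \<in> carrier (M2 R)" if "\<beta> \<in> T" for \<beta>
    using that T by (auto simp: mat_transversal_def simp del: carrier_M2)
  have fin: "finite A" "finite D" "finite T"
    using A D T by (auto simp: transversal_def mat_transversal_def)
  have msim_refl: "msim k \<alpha> \<alpha>" if "\<alpha> \<in> carrier (M2 R)" for k \<alpha>
    unfolding msim_def
  proof (intro bexI conjI)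
    show "mdet R \<one>\<^bsub>M2 R\<^esub> \<notin> \<mm>" using one_imp_carrier I_notcarr by auto
    show "mred k (\<one>\<^bsub>M2 R\<^esub> \<otimes>\<^bsub>M2 R\<^esub> \<alpha>) = mred k (\<alpha> \<otimes>\<^bsub>M2 R\<^esub> \<one>\<^bsub>M2 R\<^esub>)"
      using M.l_one[OF that] M.r_one[OF that] by simp
    show "\<one>\<^bsub>M2 R\<^esub> \<in> carrier (M2 R)" by (rule M.one_closed)
  qed
  have injC: "inj_on (\<lambda>(t, e). companion t e) (A \<times> A)"
  proof (rule inj_onI, clarify)
    fix t e t' e' assume "t \<in> A" "e \<in> A" "t' \<in> A" "e' \<in> A" "companion t e = companion t' e'"
    then show "t = t' \<and> e = e'"
      using Ac mdet_companion mtrace_companion by metis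
  qed
  have injS: "inj_on (\<lambda>(d, \<beta>). shift d \<beta>) (D \<times> T)"
  proof (rule inj_onI, clarify)
    fix d \<beta> d' \<beta>' assume a: "d \<in> D" "\<beta> \<in> T" "d' \<in> D" "\<beta>' \<in> T" "shift d \<beta> = shift d' \<beta>'"
    then have s: "msim (Suc n) (shift d \<beta>) (shift d' \<beta>')"
      using msim_refl[OF shift_closed[OF Dc Tc]] by metis
    have "\<mm> +> d = \<mm> +> d'"
      using msim_shift_coset_eq[OF Dc Tc Dc Tc s] a by blast
    then have d: "d = d'"
      using D a by (auto simp: transversal_def mpow_1 dest: inj_onD)
    then have "msim n \<beta> \<beta>'"
      using msim_shift_iff[OF n] a s Dc Tc by blast
    then show "d = d' \<and> \<beta> = \<beta>'" using T a d by (auto simp: mat_transversal_def)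
  qed
  have disj: "companion t e \<noteq> shift d \<beta>" if "t \<in> A" "e \<in> A" "d \<in> D" "\<beta> \<in> T" for t e d \<beta>
    using not_msim_companion_shift(1)[OF Ac Ac Dc Tc] msim_refl[OF shift_closed[OF Dc Tc]] that
    by metis
  have card_Un: "card ((\<lambda>(t, e). companion t e) ` P \<union> (\<lambda>(d, \<beta>). shift d \<beta>) ` Q) = card P + card Q"
    if "P \<subseteq> A \<times> A" "Q \<subseteq> D \<times> T" for P Q
  proof -
    have "finite P" "finite Q"
      using that fin by (auto intro: finite_subset)
    moreover have "(\<lambda>(t, e). companion t e) ` P \<inter> (\<lambda>(d, \<beta>). shift d \<beta>) ` Q = {}"
      using that disj by force
    ultimately show ?thesis
      using inj_on_subset[OF injC that(1)] inj_on_subset[OF injS that(2)]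
      by (simp add: card_Un_disjoint card_image)
  qed
  show "card U = card A * card A + card D * card T"
    unfolding U_def by (subst card_Un) (simp_all add: card_cartesian_product)
  have "mdet R (companion t e) = e" if "t \<in> A" "e \<in> A" for t e
    using that Ac mdet_companion by blast
  moreover have "mdet R (shift d \<beta>) \<in> \<mm> \<longleftrightarrow> d \<in> \<mm>" if "d \<in> D" "\<beta> \<in> T" for d \<beta>
    using that Dc Tc mdet_shift_mem_iff by blast
  ultimately have "{\<alpha>\<in>U. mdet R \<alpha> \<notin> \<mm>} =
    (\<lambda>(t, e). companion t e) ` (A \<times> (A - \<mm>)) \<union> (\<lambda>(d, \<beta>). shift d \<beta>) ` ((D - \<mm>) \<times> T)"
    unfolding U_def by (auto simp del: carrier_M2)
  also have "card \<dots> = card A * card (A - \<mm>) + card (D - \<mm>) * card T"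
    by (subst card_Un) (auto simp: card_cartesian_product)
  finally show "card {\<alpha>\<in>U. mdet R \<alpha> \<notin> \<mm>} = card A * card (A - \<mm>) + card (D - \<mm>) * card T" .
qed

lemma ex_mat_transversal:
  assumes D: "transversal (Suc 0) D" "card (D - \<mm>) = card D - 1" "card D \<ge> 2"
  defines "q \<equiv> real (card D)"
  shows "enat n \<le> local_length R \<mm> \<Longrightarrow> \<exists>T. mat_transversal n T \<and>
    real (card T) * (q - 1) = q ^ (2 * n + 1) - q ^ n \<and>
    (n \<ge> 1 \<longrightarrow> real (card {\<alpha>\<in>T. mdet R \<alpha> \<notin> \<mm>}) = q ^ (2 * n) - q ^ (n - 1))"
proof (induction n)
  case 0
  interpret M: ring "M2 R" by (rule M2_ring)
  have coset_0: "mpow 0 +> x = mpow 0 +> y" if "x \<in> carrier R" "y \<in> carrier R" for x y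
    using coset_eq_iff[OF that, of 0] minus_closed[OF that] unfolding mpow_0 by blast
  have "mred 0 X = mred 0 Y" if "X \<in> carrier (M2 R)" "Y \<in> carrier (M2 R)" for X Y
    using that by clarsimp (intro conjI coset_0)
  then have sim: "msim 0 \<alpha> \<alpha>'" if "\<alpha> \<in> carrier (M2 R)" "\<alpha>' \<in> carrier (M2 R)" for \<alpha> \<alpha>'
    unfolding msim_def
  proof (intro bexI conjI)
    show "mdet R \<one>\<^bsub>M2 R\<^esub> \<notin> \<mm>" using one_imp_carrier I_notcarr by auto
  qed (use that M.m_closed M.one_closed in blast)+
  have "mat_transversal 0 {\<one>\<^bsub>M2 R\<^esub>}"
    unfolding mat_transversal_def using sim M.one_closed by blast
  then show ?case by (intro exI[of _ "{\<one>\<^bsub>M2 R\<^esub>}"]) simp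
next
  case (Suc n)
  have "enat n \<le> local_length R \<mm>"
    by (rule order_trans[OF _ Suc.prems]) simp
  with Suc.IH obtain T where T: "mat_transversal n T"
    "real (card T) * (q - 1) = q ^ (2 * n + 1) - q ^ n" by blast
  obtain A where A: "transversal (Suc n) A" "card A = card D ^ Suc n"
    "card (A - \<mm>) = (card D - 1) * card D ^ n"
    using ex_transversal[OF D(1,2) Suc.prems] by auto
  let ?U = "(\<lambda>(t, e). companion t e) ` (A \<times> A) \<union> (\<lambda>(d, \<beta>). shift d \<beta>) ` (D \<times> T)"
  note c = card_companion_shift[OF Suc.prems D(1) A(1) T(1)]
  have q1: "real (card D - 1) = q - 1" using D(3) by (simp add: q_def of_nat_diff)
  have "real (card ?U) * (q - 1) = q ^ (2 * n + 2) * (q - 1) + q * (real (card T) * (q - 1))"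
    unfolding c(1) A(2) by (simp add: q_def[symmetric] algebra_simps flip: power_add mult_2_right)
  then have 1: "real (card ?U) * (q - 1) = q ^ (2 * Suc n + 1) - q ^ Suc n"
    unfolding T(2) by (simp add: algebra_simps)
  have "real (card {\<alpha>\<in>?U. mdet R \<alpha> \<notin> \<mm>}) = q ^ (2 * n + 1) * (q - 1) + real (card T) * (q - 1)"
    unfolding c(2) A D(2) of_nat_add of_nat_mult of_nat_power q1
    by (simp add: q_def[symmetric] algebra_simps flip: power_add mult_2_right)
  then have 2: "real (card {\<alpha>\<in>?U. mdet R \<alpha> \<notin> \<mm>}) = q ^ (2 * Suc n) - q ^ (Suc n - 1)"
    unfolding T(2) by (simp add: algebra_simps)
  show ?case
    using mat_transversal_Suc[OF Suc.prems D(1) A(1) T(1)] 1 2 by blast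
qed

lemma card_similarity_classes:
  assumes n: "1 \<le> n" and T: "mat_transversal n T"
  shows "card (similarity_classes (R Quot mpow n) (carrier (M2 (R Quot mpow n)))) = card T"
    and "card (similarity_classes (R Quot mpow n) (GL2 (R Quot mpow n))) =
      card {\<alpha>\<in>T. mdet R \<alpha> \<notin> \<mm>}"
proof -
  interpret h: ring_hom_cring R "R Quot mpow n" "(+>) (mpow n)" by (rule quot_hom)
  interpret M: ring "M2 (R Quot mpow n)" by (rule h.S.M2_ring)
  have Tc: "\<beta> \<in> carrier (M2 R)" if "\<beta> \<in> T" for \<beta>
    using that T by (auto simp: mat_transversal_def simp del: carrier_M2)
  have rT: "mred n t \<in> carrier (M2 (R Quot mpow n))" if "t \<in> T" for t
    using Tc[OF that] mred_image by blast
  have eq: "t = t'" if "t \<in> T" "t' \<in> T" "similar_mat2 (R Quot mpow n) (mred n t) (mred n t')" for t t'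
    using that T Tc msim_iff_similar_mat2[OF n] unfolding mat_transversal_def by blast
  have refl: "similar_mat2 (R Quot mpow n) \<alpha> \<alpha>" if "\<alpha> \<in> carrier (M2 (R Quot mpow n))" for \<alpha>
    using equivE[OF h.S.equiv_similar_mat2[OF order_refl]] that
    by (auto simp: refl_on_def simp del: carrier_M2)
  have inj: "inj_on (mred n) T"
    by (rule inj_onI) (metis eq refl rT)
  have ex: "\<exists>t\<in>T. similar_mat2 (R Quot mpow n) Y (mred n t)"
    if "Y \<in> carrier (M2 (R Quot mpow n))" for Y
  proof -
    have "Y \<in> mred n ` carrier (M2 R)" using that mred_image by blast
    then obtain X where X: "X \<in> carrier (M2 R)" "Y = mred n X" by (rule imageE)
    then obtain t where "t \<in> T" "msim n X t" using T unfolding mat_transversal_def by blast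
    then show ?thesis using X Tc msim_iff_similar_mat2[OF n] by blast
  qed
  show "card (similarity_classes (R Quot mpow n) (carrier (M2 (R Quot mpow n)))) = card T"
    unfolding similarity_classes_def
    by (rule card_quotient_transversal[OF h.S.equiv_similar_mat2[OF order_refl] inj])
      (use rT eq ex in \<open>auto simp del: carrier_M2\<close>)
  have GLc: "GL2 (R Quot mpow n) \<subseteq> carrier (M2 (R Quot mpow n))"
    unfolding Units_def by blast
  have GL: "mred n t \<in> GL2 (R Quot mpow n) \<longleftrightarrow> mdet R t \<notin> \<mm>" if "t \<in> T" for t
    using GL2_quot_iff[OF n Tc[OF that]] .
  have exGL: "\<exists>t\<in>{\<alpha>\<in>T. mdet R \<alpha> \<notin> \<mm>}. mred n t \<in> GL2 (R Quot mpow n) \<and> similar_mat2 (R Quot mpow n) Y (mred n t)"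
    if Y: "Y \<in> GL2 (R Quot mpow n)" for Y
  proof -
    obtain t where t: "t \<in> T" "similar_mat2 (R Quot mpow n) Y (mred n t)"
      using ex Y GLc by blast
    have "mdet (R Quot mpow n) Y = mdet (R Quot mpow n) (mred n t)"
      using h.S.similar_mat2_invariants(1)[OF _ rT[OF t(1)] t(2)] Y GLc by blast
    then have "mred n t \<in> GL2 (R Quot mpow n)"
      using h.S.GL2_iff[OF rT[OF t(1)]] h.S.GL2_iff[of Y] Y GLc by auto
    then show ?thesis using t GL by blast
  qed
  show "card (similarity_classes (R Quot mpow n) (GL2 (R Quot mpow n))) =
      card {\<alpha>\<in>T. mdet R \<alpha> \<notin> \<mm>}"
    unfolding similarity_classes_def
  proof (rule card_quotient_transversal[OF h.S.equiv_similar_mat2[OF GLc]])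
    show "inj_on (mred n) {\<alpha>\<in>T. mdet R \<alpha> \<notin> \<mm>}"
      using inj by (rule inj_on_subset) blast
    show "mred n ` {\<alpha>\<in>T. mdet R \<alpha> \<notin> \<mm>} \<subseteq> GL2 (R Quot mpow n)"
      using GL by blast
  qed (use eq exGL in blast)+
qed

end

theorem mainTheorem4:
  fixes A :: "('a, 'b) ring_scheme" and \<mm> :: "'a set" and q i :: nat
  assumes "local_principal_ideal_ring A \<mm>"
    and "finite (carrier (A Quot \<mm>))" and "q = card (carrier (A Quot \<mm>))"
    and "1 \<le> i" and "enat i \<le> local_length A \<mm>"
  shows "let Ai = A Quot (ideal_power A \<mm> i) in
    real (card (similarity_classes Ai (carrier (M2 Ai))))
      = (real q ^ (2 * i + 1) - real q ^ i) / (real q - 1) \<and>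
    real (card (similarity_classes Ai (GL2 Ai))) = real q ^ (2 * i) - real q ^ (i - 1)"
proof -
  interpret local_principal_ideal_ring A \<mm> by fact
  obtain p where p: "p \<in> carrier A" "\<mm> = PIdl\<^bsub>A\<^esub> p"
    using principalideal.generate[OF all_ideals_principal[OF is_ideal]] cgenideal_eq_genideal by metis
  interpret uniformized_ring A \<mm> p
    by unfold_locales (use p in auto)
  obtain D where D: "transversal (Suc 0) D" "card D = q" "card (D - \<mm>) = card D - 1" "card D \<ge> 2"
    using residue_transversal[OF assms(2)] assms(3) by metis
  obtain T where T: "mat_transversal i T"
    "real (card T) * (real q - 1) = real q ^ (2 * i + 1) - real q ^ i"
    "real (card {\<alpha>\<in>T. mdet A \<alpha> \<notin> \<mm>}) = real q ^ (2 * i) - real q ^ (i - 1)"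
    using ex_mat_transversal[OF D(1,3,4) assms(5)] assms(4) D(2) by auto
  have "real q - 1 \<noteq> 0" using D(2,4) by simp
  then have "real (card T) = (real q ^ (2 * i + 1) - real q ^ i) / (real q - 1)"
    using T(2) by (simp add: field_simps)
  then show ?thesis
    unfolding Let_def ideal_power_eq card_similarity_classes[OF assms(4) T(1)]
    using T(3) by simp
qed

end
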